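(* Let $\mu,\nu\in\mathcal{P}(\mathbb{R})$ be probability measures on $\mathbb{R}$, with $\mu$ absolutely continuous with respect to the Lebesgue measure. Let $F_\mu^{\nearrow}(x)=\mu((-\infty,x])$ be the cumulative distribution function of $\mu$ and $F_\mu^{\searrow}(x)=\mu([x,+\infty))$ its anti-cumulative distribution function. Define $T_{asc}:\mathbb{R}\to\mathbb{R}$ by $T_{asc}(x)=F_\nu^{-1}(F_\mu^{\nearrow}(x))$ and $T_{desc}:\mathbb{R}\to\mathbb{R}$ by $T_{desc}(x)=F_\nu^{-1}(F_\mu^{\searrow}(x))$. Then an optimal solution of $$\inf_{\pi\in\Pi(\mu,\nu)}\iint(xx'-yy')^2\,d\pi(x,y)\,d\pi(x',y')$$ is achieved by $\gamma=(\mathrm{id}\times T_{asc})\#\mu$ or by $\gamma=(\mathrm{id}\times T_{desc})\#\mu$.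
   Context: $\Pi(\mu,\nu)$ is the set of couplings of $\mu$ and $\nu$; $(\mathrm{id}\times T)\#\mu$ is the push-forward of $\mu$ by $x\mapsto(x,T(x))$; $F_\nu^{-1}(s)=\inf\{t\in\mathbb{R}:\nu((-\infty,t])\ge s\}$ is the generalized inverse of the cumulative distribution function of $\nu$. *)

theory Defs
  imports "HOL-Probability.Probability"
begin

definition couplings :: "real measure \<Rightarrow> real measure \<Rightarrow> (real \<times> real) measure set" where
  "couplings \<mu> \<nu> = {\<pi>. prob_space \<pi> \<and> sets \<pi> = sets (borel \<Otimes>\<^sub>M borel) \<and>
     distr \<pi> borel fst = \<mu> \<and> distr \<pi> borel snd = \<nu>}"

text \<open>The objective is a Lebesgue integral with values in \<open>[0, \<infinity>]\<close>, since no
  moments of the marginals are assumed to be finite.\<close>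

definition gw_cost :: "(real \<times> real) measure \<Rightarrow> ennreal" where
  "gw_cost \<pi> = (\<integral>\<^sup>+ (x', y'). \<integral>\<^sup>+ (x, y). ennreal ((x * x' - y * y')\<^sup>2) \<partial>\<pi> \<partial>\<pi>)"

definition gw_optimal :: "real measure \<Rightarrow> real measure \<Rightarrow> (real \<times> real) measure \<Rightarrow> bool" where
  "gw_optimal \<mu> \<nu> \<gamma> \<longleftrightarrow>
     \<gamma> \<in> couplings \<mu> \<nu> \<and> gw_cost \<gamma> = (INF \<pi>\<in>couplings \<mu> \<nu>. gw_cost \<pi>)"

definition anti_cdf :: "real measure \<Rightarrow> real \<Rightarrow> real" where
  "anti_cdf M x = measure M {x..}"

text \<open>The infimum is finite for \<open>0 < s < 1\<close>. The set is all of \<open>\<real>\<close> for \<open>s = 0\<close> and may be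
  empty for \<open>s = 1\<close>; there \<open>Inf\<close> returns an arbitrary real constant. This does not affect the
  push-forwards below, because for atomless \<open>\<mu>\<close> the points where \<open>cdf \<mu>\<close> or \<open>anti_cdf \<mu>\<close>
  takes the value 0 or 1 form a \<open>\<mu>\<close>-null set.\<close>

definition quantile :: "real measure \<Rightarrow> real \<Rightarrow> real" where
  "quantile M s = Inf {t. s \<le> cdf M t}"

definition T_asc :: "real measure \<Rightarrow> real measure \<Rightarrow> real \<Rightarrow> real" where
  "T_asc \<mu> \<nu> x = quantile \<nu> (cdf \<mu> x)"

definition T_desc :: "real measure \<Rightarrow> real measure \<Rightarrow> real \<Rightarrow> real" where
  "T_desc \<mu> \<nu> x = quantile \<nu> (anti_cdf \<mu> x)"

definition graph_pushforward :: "real measure \<Rightarrow> (real \<Rightarrow> real) \<Rightarrow> (real \<times> real) measure" where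
  "graph_pushforward \<mu> T = distr \<mu> (borel \<Otimes>\<^sub>M borel) (\<lambda>x. (x, T x))"

end

theory Submission
  imports Defs
begin

text \<open>If both marginals have finite second moments \<open>A\<close> and \<open>B\<close>, expanding the square shows that the
  cost of \<open>\<pi>\<close> is \<open>A\<^sup>2 + B\<^sup>2 - 2 C(\<pi>)\<^sup>2\<close> with \<open>C(\<pi>) = \<integral> x y d\<pi>\<close>. By Hoeffding's formula \<open>C\<close> is
  monotone in the joint distribution function, which lies between the Frechet bounds
  \<open>max 0 (F + G - 1)\<close> and \<open>min F G\<close>; these are attained by the descending and the ascending map. So
  \<open>C\<close> ranges in an interval whose endpoints belong to the two maps, and \<open>C\<^sup>2\<close> is maximal at one of
  them. If a second moment is infinite, a coupling of finite cost must be carried by the line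
  \<open>y = x\<close> or \<open>y = - x\<close>; then the ascending or the descending map coincides almost everywhere with
  \<open>x\<close> or \<open>- x\<close> and has cost zero.\<close>

text \<open>\<open>arctan\<close> is bounded and strictly increasing, so composing with it makes
  both functions integrable without any moment assumption. The difference of the compositions is
  then nonnegative almost everywhere and has integral 0.\<close>

lemma (in prob_space) AE_eq_if_AE_le_distr_eq:
  fixes f g :: "'a \<Rightarrow> real"
  assumes [measurable]: "random_variable borel f" "random_variable borel g"
    and le: "AE x in M. f x \<le> g x"
    and eq: "distr M borel f = distr M borel g"
  shows "AE x in M. f x = g x"
proof -
  have bnd: "\<bar>arctan x\<bar> \<le> pi" for x
    using arctan_bounded[of x] by (simp add: abs_le_iff)
  have arc [measurable]: "arctan \<in> borel_measurable borel"
    by (intro borel_measurable_continuous_onI continuous_on_arctan continuous_on_id)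
  have int: "integrable M (\<lambda>x. arctan (h x))" if [measurable]: "random_variable borel h" for h
    by (rule integrable_const_bound[where B=pi]) (auto simp: bnd)
  have "(\<integral>x. arctan (f x) \<partial>M) = (\<integral>x. arctan (g x) \<partial>M)"
    using integral_distr[of f M borel arctan] integral_distr[of g M borel arctan] by (simp add: eq)
  then have "(\<integral>x. arctan (g x) - arctan (f x) \<partial>M) = 0"
    by (simp add: int)
  then have "AE x in M. arctan (g x) - arctan (f x) = 0"
    using le by (subst (asm) integral_nonneg_eq_0_iff_AE) (auto simp: int arctan_le_iff)
  then show ?thesis
    by eventually_elim (simp add: arctan_eq_iff)
qed

section \<open>Couplings, joint distribution functions and Hoeffding's formula\<close>

locale coupling = prob_space \<pi> for \<pi> :: "(real \<times> real) measure" and \<mu> \<nu> :: "real measure" +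
  assumes sets_coupling [simp, measurable_cong]: "sets \<pi> = sets (borel \<Otimes>\<^sub>M borel)"
    and distr_fst: "distr \<pi> borel fst = \<mu>"
    and distr_snd: "distr \<pi> borel snd = \<nu>"

lemma mem_couplings_iff: "\<pi> \<in> couplings \<mu> \<nu> \<longleftrightarrow> coupling \<pi> \<mu> \<nu>"
  by (auto simp: couplings_def coupling_def coupling_axioms_def)

definition joint_cdf :: "(real \<times> real) measure \<Rightarrow> real \<Rightarrow> real \<Rightarrow> real" where
  "joint_cdf \<pi> s t = measure \<pi> ({..s} \<times> {..t})"

text \<open>Layer-cake kernel: subtracting the value at 0 leaves, as a function of \<open>s\<close>,
  a signed indicator of the interval between 0 and \<open>x\<close>. It is therefore integrable,
  with integral \<open>- x\<close>; the sign cancels in a product of two kernels.\<close>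

definition level_step :: "real \<Rightarrow> real \<Rightarrow> real" where
  "level_step s x = indicator {..s} x - indicator {..s} 0"

lemma level_step_eq: "level_step s x = indicator {x..<0} s - indicator {0..<x} s"
  by (auto simp: level_step_def indicator_def)

lemma abs_level_step_eq: "\<bar>level_step s x\<bar> = indicator {x..<0} s + indicator {0..<x} s"
  by (auto simp: level_step_def indicator_def)

lemma integrable_level_step: "integrable lborel (\<lambda>s. level_step s x)"
  unfolding level_step_eq by (intro Bochner_Integration.integrable_diff) (cases "0 \<le> x"; auto simp: integrable_real_indicator)+

lemma integral_level_step: "(\<integral>s. level_step s x \<partial>lborel) = - x"
  unfolding level_step_eq by (cases "0 \<le> x") simp_all

lemma integral_abs_level_step: "(\<integral>s. \<bar>level_step s x\<bar> \<partial>lborel) = \<bar>x\<bar>"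
  unfolding abs_level_step_eq by (cases "0 \<le> x") simp_all

lemma borel_measurable_level_step [measurable]:
  assumes [measurable]: "f \<in> borel_measurable M" "g \<in> borel_measurable M"
  shows "(\<lambda>z. level_step (f z) (g z)) \<in> borel_measurable M"
  unfolding level_step_def indicator_def atMost_iff by measurable

context coupling
begin

lemma integrable_fst_iff:
  "f \<in> borel_measurable borel \<Longrightarrow> integrable \<pi> (\<lambda>z. f (fst z)) \<longleftrightarrow> integrable \<mu> (f :: real \<Rightarrow> real)"
  by (subst distr_fst[symmetric], subst integrable_distr_eq) simp_all

lemma integrable_snd_iff:
  "f \<in> borel_measurable borel \<Longrightarrow> integrable \<pi> (\<lambda>z. f (snd z)) \<longleftrightarrow> integrable \<nu> (f :: real \<Rightarrow> real)"
  by (subst distr_snd[symmetric], subst integrable_distr_eq) simp_all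

lemma integral_fst_eq:
  "f \<in> borel_measurable borel \<Longrightarrow> (\<integral>z. f (fst z) \<partial>\<pi>) = integral\<^sup>L \<mu> (f :: real \<Rightarrow> real)"
  by (subst distr_fst[symmetric], subst integral_distr) simp_all

lemma integral_snd_eq:
  "f \<in> borel_measurable borel \<Longrightarrow> (\<integral>z. f (snd z) \<partial>\<pi>) = integral\<^sup>L \<nu> (f :: real \<Rightarrow> real)"
  by (subst distr_snd[symmetric], subst integral_distr) simp_all

lemma space_coupling [simp]: "space \<pi> = UNIV"
  using sets_eq_imp_space_eq[OF sets_coupling] by (simp add: space_pair_measure)

lemma cdf_fst: "cdf \<mu> s = prob {z. fst z \<le> s}"
  unfolding cdf_def distr_fst[symmetric] by (subst measure_distr) (auto simp: vimage_def)

lemma cdf_snd: "cdf \<nu> t = prob {z. snd z \<le> t}"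
  unfolding cdf_def distr_snd[symmetric] by (subst measure_distr) (auto simp: vimage_def)

lemma sets_coupling_le [simp]:
  "{z. fst z \<le> s} \<in> sets (borel \<Otimes>\<^sub>M borel)" "{z. snd z \<le> t} \<in> sets (borel \<Otimes>\<^sub>M borel)"
  "{z. fst z \<le> s \<and> snd z \<le> t} \<in> sets (borel \<Otimes>\<^sub>M borel)" for s t :: real
proof -
  have "{z \<in> space (borel \<Otimes>\<^sub>M borel). fst z \<le> s} \<in> sets (borel \<Otimes>\<^sub>M borel)"
    "{z \<in> space (borel \<Otimes>\<^sub>M borel). snd z \<le> t} \<in> sets (borel \<Otimes>\<^sub>M borel)"
    "{z \<in> space (borel \<Otimes>\<^sub>M borel). fst z \<le> s \<and> snd z \<le> t} \<in> sets (borel \<Otimes>\<^sub>M borel)"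
    by measurable
  then show "{z. fst z \<le> s} \<in> sets (borel \<Otimes>\<^sub>M borel)" "{z. snd z \<le> t} \<in> sets (borel \<Otimes>\<^sub>M borel)"
    "{z. fst z \<le> s \<and> snd z \<le> t} \<in> sets (borel \<Otimes>\<^sub>M borel)"
    by (simp_all add: space_pair_measure)
qed

lemma joint_cdf_eq: "joint_cdf \<pi> s t = prob {z. fst z \<le> s \<and> snd z \<le> t}"
  by (auto simp: joint_cdf_def intro!: arg_cong[where f=prob])

lemma joint_cdf_le: "joint_cdf \<pi> s t \<le> min (cdf \<mu> s) (cdf \<nu> t)"
  unfolding joint_cdf_eq cdf_fst cdf_snd by (intro min.boundedI finite_measure_mono) auto

lemma joint_cdf_ge: "max 0 (cdf \<mu> s + cdf \<nu> t - 1) \<le> joint_cdf \<pi> s t"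
proof -
  let ?A = "{z::real \<times> real. fst z \<le> s}" and ?B = "{z::real \<times> real. snd z \<le> t}"
  have "prob (?A \<union> ?B) = prob ?A + prob ?B - prob (?A \<inter> ?B)"
    by (rule measure_Un3) (auto simp: fmeasurable_eq_sets)
  moreover have "prob (?A \<union> ?B) \<le> 1"
    by simp
  moreover have "?A \<inter> ?B = {z. fst z \<le> s \<and> snd z \<le> t}"
    by auto
  ultimately show ?thesis
    unfolding joint_cdf_eq cdf_fst cdf_snd by simp
qed

text \<open>Only the first term depends on how the marginals are coupled. For fixed marginals these
  integrals are thus ordered as the joint distribution functions are.\<close>

lemma integral_level_step_mult:
  "(\<integral>z. level_step s (fst z) * level_step t (snd z) \<partial>\<pi>) =
     joint_cdf \<pi> s t - indicator {..t} 0 * cdf \<mu> s - indicator {..s} 0 * cdf \<nu> t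
       + indicator {..s} 0 * indicator {..t} 0"
proof -
  have "level_step s (fst z) * level_step t (snd z) =
      indicator {z. fst z \<le> s \<and> snd z \<le> t} z - indicator {..t} 0 * indicator {z. fst z \<le> s} z
       - indicator {..s} 0 * indicator {z. snd z \<le> t} z + indicator {..s} 0 * indicator {..t} (0::real)" for z
    by (simp add: level_step_def indicator_def algebra_simps)
  then show ?thesis
    using prob_space by (simp add: joint_cdf_eq cdf_fst cdf_snd less_top[symmetric])
qed

text \<open>Hoeffding's formula: the layer-cake representation of both factors reduces the mixed moment
  to the joint distribution function.\<close>

lemma Hoeffding:
  assumes "integrable \<pi> (\<lambda>z. fst z * snd z)"
  defines "K \<equiv> \<lambda>p. \<integral>z. level_step (fst p) (fst z) * level_step (snd p) (snd z) \<partial>\<pi>"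
  shows integrable_Hoeffding: "integrable (lborel \<Otimes>\<^sub>M lborel) K"
    and integral_Hoeffding: "(\<integral>z. fst z * snd z \<partial>\<pi>) = integral\<^sup>L (lborel \<Otimes>\<^sub>M lborel) K"
proof -
  interpret P: pair_sigma_finite \<pi> "lborel \<Otimes>\<^sub>M lborel :: (real \<times> real) measure"
    by (intro pair_sigma_finite.intro sigma_finite_measure_axioms sigma_finite_pair_measure lborel.sigma_finite_measure_axioms)
  define F :: "real \<times> real \<Rightarrow> real \<times> real \<Rightarrow> real"
    where "F z p = level_step (fst p) (fst z) * level_step (snd p) (snd z)" for z p
  have meas: "(\<lambda>q. F (fst q) (snd q)) \<in> borel_measurable (\<pi> \<Otimes>\<^sub>M (lborel \<Otimes>\<^sub>M lborel))"
    unfolding F_def by measurable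
  have Fz: "F z \<in> borel_measurable (lborel \<Otimes>\<^sub>M lborel)" for z
    unfolding F_def by measurable
  have int: "integrable (lborel \<Otimes>\<^sub>M lborel) (F z)" for z
  proof (rule lborel_pair.Fubini_integrable[OF Fz])
    show "AE s in lborel. integrable lborel (\<lambda>t. F z (s, t))"
      by (simp add: F_def integrable_level_step)
    show "integrable lborel (\<lambda>s. \<integral>t. norm (F z (s, t)) \<partial>lborel)"
      by (simp add: F_def abs_mult integrable_level_step integrable_abs)
  qed
  have abs_int: "(\<integral>p. \<bar>F z p\<bar> \<partial>(lborel \<Otimes>\<^sub>M lborel)) = \<bar>fst z * snd z\<bar>" for z
    using lborel_pair.integral_fst[of "\<lambda>s t. \<bar>F z (s, t)\<bar>"] integrable_abs[OF int[of z]]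
    by (simp add: F_def[abs_def] abs_mult integral_abs_level_step split_beta')
  have int_eq: "(\<integral>p. F z p \<partial>(lborel \<Otimes>\<^sub>M lborel)) = fst z * snd z" for z
    using lborel_pair.integral_fst[of "\<lambda>s t. F z (s, t)"] int[of z]
    by (simp add: F_def[abs_def] integral_level_step split_beta')
  \<comment> \<open>By \<open>abs_int\<close>, integrating \<open>\<bar>F z p\<bar>\<close> over
    \<open>p\<close> gives \<open>\<bar>fst z * snd z\<bar>\<close>, which is integrable by
    assumption; this is the condition for Fubini.\<close>
  have "integrable (\<pi> \<Otimes>\<^sub>M (lborel \<Otimes>\<^sub>M lborel)) (\<lambda>q. F (fst q) (snd q))"
    using assms(1) by (intro P.Fubini_integrable meas) (auto simp: int abs_int)
  then have FI: "integrable (\<pi> \<Otimes>\<^sub>M (lborel \<Otimes>\<^sub>M lborel)) (case_prod F)"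
    by (simp add: split_beta')
  have K: "K = (\<lambda>p. \<integral>z. F z p \<partial>\<pi>)"
    by (simp add: K_def F_def)
  show "integrable (lborel \<Otimes>\<^sub>M lborel) K"
    unfolding K by (rule P.integrable_snd[OF FI])
  show "(\<integral>z. fst z * snd z \<partial>\<pi>) = integral\<^sup>L (lborel \<Otimes>\<^sub>M lborel) K"
    using P.Fubini_integral[OF FI] by (simp add: K int_eq)
qed

end

lemma integral_mult_mono_joint_cdf:
  assumes "coupling \<pi> \<mu> \<nu>" "coupling \<pi>' \<mu> \<nu>"
    and "integrable \<pi> (\<lambda>z. fst z * snd z)" "integrable \<pi>' (\<lambda>z. fst z * snd z)"
    and "\<And>s t. joint_cdf \<pi> s t \<le> joint_cdf \<pi>' s t"
  shows "(\<integral>z. fst z * snd z \<partial>\<pi>) \<le> (\<integral>z. fst z * snd z \<partial>\<pi>')"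
  unfolding coupling.integral_Hoeffding[OF assms(1,3)] coupling.integral_Hoeffding[OF assms(2,4)]
proof (rule integral_mono)
  fix p
  show "(\<integral>z. level_step (fst p) (fst z) * level_step (snd p) (snd z) \<partial>\<pi>) \<le>
      (\<integral>z. level_step (fst p) (fst z) * level_step (snd p) (snd z) \<partial>\<pi>')"
    using assms(5)[of "fst p" "snd p"]
    by (simp add: coupling.integral_level_step_mult[OF assms(1)] coupling.integral_level_step_mult[OF assms(2)])
qed (rule coupling.integrable_Hoeffding[OF assms(1,3)] coupling.integrable_Hoeffding[OF assms(2,4)])+

subsection \<open>Monotone maps between distributions\<close>

text \<open>For levels strictly between 0 and 1 the infimum is attained by right continuity, so
  \<open>quantile M\<close> and \<open>cdf M\<close> form a Galois connection.\<close>

lemma (in cdf_distribution) quantile_le_iff: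
  assumes "0 < s" "s < 1"
  shows "quantile M s \<le> t \<longleftrightarrow> s \<le> cdf M t"
  unfolding quantile_def by (rule pseudoinverse[OF assms, symmetric])

text \<open>On \<open>{0<..<1}\<close> this is the measurable pseudoinverse \<open>I\<close>.
  Elsewhere the defaults of \<open>Inf\<close> are constant for \<open>s \<le> 0\<close> and for
  \<open>s > 1\<close>, which leaves the single point 1.\<close>

lemma (in cdf_distribution) borel_measurable_quantile [measurable]:
  "quantile M \<in> borel_measurable borel"
proof -
  have "quantile M s = Inf UNIV" if "s \<le> 0" for s
    using order_trans[OF that cdf_nonneg] by (simp add: quantile_def)
  moreover have "quantile M s = Inf {}" if "1 < s" for s
  proof -
    have "\<not> s \<le> cdf M t" for t
      using cdf_bounded_prob[of t] that by linarith
    then show ?thesis by (simp add: quantile_def)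
  qed
  ultimately have eq: "quantile M = (\<lambda>s. if s \<in> {0<..<1} then I s else
      if s \<le> 0 then Inf UNIV else if s = 1 then quantile M 1 else Inf {})"
    by (auto simp: fun_eq_iff quantile_def)
  have "(\<lambda>s. if s \<in> {0<..<1} then I s else if s \<le> 0 then Inf UNIV else if s = 1 then quantile M 1 else Inf {})
      \<in> borel_measurable borel"
  proof (subst measurable_If_restrict_space_iff; (intro conjI)?)
    have "{x. x \<in> {0<..<1::real}} = {0<..<1}"
      by blast
    then show "I \<in> borel_measurable (restrict_space borel {x. x \<in> {0<..<1}})"
      using measurable_CI by (simp only:)
    show "(\<lambda>s::real. if s \<le> 0 then Inf UNIV else if s = 1 then quantile M 1 else Inf {})
        \<in> borel_measurable (restrict_space borel {x. x \<notin> {0<..<1}})"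
      by (intro measurable_restrict_space1 measurable_If) simp_all
  qed simp
  then show ?thesis
    unfolding eq[symmetric] .
qed

context cdf_distribution
begin

context
  assumes atomless: "\<And>x. measure M {x} = 0"
begin

lemma atomless_prob_lessThan: "prob {..<x} = cdf M x"
proof -
  have "{..x} = {..<x} \<union> {x}" by auto
  then show ?thesis
    using finite_measure_Union[of "{..<x}" "{x}"] atomless[of x] by (simp add: cdf_def)
qed

lemma anti_cdf_eq: "anti_cdf M x = 1 - cdf M x"
proof -
  have "{x..} = space M - {..<x}" by auto
  then show ?thesis
    by (simp only: anti_cdf_def) (subst prob_compl, auto simp: atomless_prob_lessThan)
qed

text \<open>One inequality is the Galois connection. For the other, \<open>cdf M\<close> stays below
  \<open>s\<close> to the left of the quantile, and without atoms it is continuous there.\<close>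

lemma cdf_quantile:
  assumes "0 < s" "s < 1"
  shows "cdf M (quantile M s) = s"
proof (rule antisym)
  show "s \<le> cdf M (quantile M s)"
    using quantile_le_iff[OF assms] by blast
  have "(cdf M \<longlongrightarrow> cdf M (quantile M s)) (at_left (quantile M s))"
    using isCont_cdf[of "quantile M s"] atomless by (simp add: isCont_def filterlim_at_split)
  moreover have "\<forall>\<^sub>F x in at_left (quantile M s). cdf M x \<le> s"
  proof -
    have "cdf M x \<le> s" if "x < quantile M s" for x
      using quantile_le_iff[OF assms, of x] that by linarith
    then show ?thesis
      by (simp add: eventually_at_filter)
  qed
  ultimately show "cdf M (quantile M s) \<le> s"
    by (rule tendsto_upperbound) simp
qed

lemma cdf_less_iff:
  assumes "0 < s" "s < 1"
  shows "cdf M x < s \<longleftrightarrow> x < quantile M s"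
  using quantile_le_iff[OF assms, of x] by linarith

text \<open>Probability integral transform: \<open>cdf M\<close> is uniformly distributed under
  \<open>M\<close>. For a level \<open>r\<close> strictly between 0 and 1 the strict sublevel set is
  a half-line ending at the quantile. Approaching \<open>s\<close> by such \<open>r\<close> from
  both sides covers the end levels and squeezes the two versions together.\<close>

lemma prob_cdf_less_and_le:
  assumes "0 \<le> s" "s \<le> 1"
  shows prob_cdf_less: "prob {x. cdf M x < s} = s"
    and prob_cdf_le: "prob {x. cdf M x \<le> s} = s"
proof -
  have less: "prob {x. cdf M x < r} = r" if "0 < r" "r < 1" for r
    unfolding cdf_less_iff[OF that] lessThan_def[symmetric] atomless_prob_lessThan
    by (rule cdf_quantile[OF that])
  have meas: "{x. cdf M x < r} \<in> events" "{x. cdf M x \<le> r} \<in> events" for r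
    by measurable
  have "prob {x. cdf M x \<le> s} \<le> r" if "s < r" for r
  proof (cases "r < 1")
    case True
    have "prob {x. cdf M x \<le> s} \<le> prob {x. cdf M x < r}"
      using that by (intro finite_measure_mono meas) auto
    then show ?thesis
      using less[of r] that True assms by linarith
  next
    case False
    then show ?thesis
      using prob_le_1[of "{x. cdf M x \<le> s}"] by linarith
  qed
  then have "prob {x. cdf M x \<le> s} \<le> s"
    by (rule dense_ge)
  moreover have "r \<le> prob {x. cdf M x < s}" if "r < s" for r
  proof (cases "0 < r")
    case True
    have "prob {x. cdf M x < r} \<le> prob {x. cdf M x < s}"
      using that by (intro finite_measure_mono meas) auto
    then show ?thesis
      using less[of r] that True assms by linarith
  next
    case False
    then show ?thesis
      using measure_nonneg[of M "{x. cdf M x < s}"] by linarith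
  qed
  then have "s \<le> prob {x. cdf M x < s}"
    by (rule dense_le)
  moreover have "prob {x. cdf M x < s} \<le> prob {x. cdf M x \<le> s}"
    by (intro finite_measure_mono meas) auto
  ultimately show "prob {x. cdf M x < s} = s" "prob {x. cdf M x \<le> s} = s"
    by linarith+
qed

text \<open>This discards the end levels, where \<open>quantile\<close> has only default
  values.\<close>

lemma AE_cdf_gt_0: "AE x in M. 0 < cdf M x"
  and AE_cdf_lt_1: "AE x in M. cdf M x < 1"
proof -
  have "AE x in M. x \<notin> {x. cdf M x \<le> 0}"
    by (subst prob_eq_0[symmetric]) (simp_all add: prob_cdf_le)
  then show "AE x in M. 0 < cdf M x"
    by (simp add: not_le)
  have "AE x in M. x \<in> {x. cdf M x < 1}"
    by (subst prob_eq_1[symmetric]) (simp_all add: prob_cdf_less)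
  then show "AE x in M. cdf M x < 1"
    by simp
qed

lemma borel_measurable_T_asc [measurable]:
  "cdf_distribution N \<Longrightarrow> T_asc M N \<in> borel_measurable borel"
  using measurable_compose[OF measurable_C cdf_distribution.borel_measurable_quantile, of N]
  by (simp add: T_asc_def[abs_def])

lemma borel_measurable_T_desc [measurable]:
  "cdf_distribution N \<Longrightarrow> T_desc M N \<in> borel_measurable borel"
  using measurable_compose[OF _ cdf_distribution.borel_measurable_quantile, of "\<lambda>x. 1 - cdf M x" borel N]
  by (simp add: T_desc_def[abs_def] anti_cdf_eq)

text \<open>The Galois connection holds off one null set for all \<open>t\<close> at once. With the
  quantifier inside, \<open>t\<close> may later depend on \<open>x\<close>, as in
  \<open>AE_T_asc_self\<close>.\<close>

lemma AE_T_asc_le_iff: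
  assumes "cdf_distribution N"
  shows "AE x in M. \<forall>t. T_asc M N x \<le> t \<longleftrightarrow> cdf M x \<le> cdf N t"
  using AE_cdf_gt_0 AE_cdf_lt_1 
  by eventually_elim (auto simp: T_asc_def cdf_distribution.quantile_le_iff[OF assms])

lemma AE_T_desc_le_iff:
  assumes "cdf_distribution N"
  shows "AE x in M. \<forall>t. T_desc M N x \<le> t \<longleftrightarrow> 1 - cdf N t \<le> cdf M x"
  using AE_cdf_gt_0 AE_cdf_lt_1 
  by eventually_elim (simp add: T_desc_def anti_cdf_eq cdf_distribution.quantile_le_iff[OF assms] diff_le_eq add.commute)

text \<open>Both conditions cut out sets closed downwards in \<open>x\<close>, so one set contains
  the other and the smaller probability remains.\<close>

lemma prob_le_cdf_le:
  assumes "0 \<le> r" "r \<le> 1"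
  shows "prob {x. x \<le> s \<and> cdf M x \<le> r} = min (cdf M s) r"
proof (cases "cdf M s \<le> r")
  case True
  then have "{x. x \<le> s \<and> cdf M x \<le> r} = {..s}"
    by (auto intro: order_trans[OF cdf_nondecreasing])
  with True show ?thesis by (simp add: cdf_def)
next
  case False
  then have "x \<le> s" if "cdf M x \<le> r" for x
    using cdf_nondecreasing[of s x] that by linarith
  then have "{x. x \<le> s \<and> cdf M x \<le> r} = {x. cdf M x \<le> r}"
    by blast
  with False show ?thesis by (simp add: prob_cdf_le assms)
qed

text \<open>Passing to the complement inside \<open>{..s}\<close> gives two nested sets again, and
  \<open>a - min a (1 - r) = max 0 (a + r - 1)\<close>.\<close>

lemma prob_le_cdf_ge:
  assumes "0 \<le> r" "r \<le> 1"
  shows "prob {x. x \<le> s \<and> 1 - r \<le> cdf M x} = max 0 (cdf M s + r - 1)"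
proof -
  let ?B = "{x. x \<le> s \<and> cdf M x < 1 - r}"
  have "?B \<in> events"
    by measurable
  then have "prob ({..s} - ?B) = cdf M s - prob ?B"
    by (subst finite_measure_Diff) (auto simp: cdf_def)
  also have "{..s} - ?B = {x. x \<le> s \<and> 1 - r \<le> cdf M x}"
    by auto
  also have "prob ?B = min (cdf M s) (1 - r)"
  proof (cases "cdf M s < 1 - r")
    case True
    then have "?B = {..s}"
      by (auto intro: le_less_trans[OF cdf_nondecreasing])
    with True show ?thesis by (simp add: cdf_def)
  next
    case False
    then have "x \<le> s" if "cdf M x < 1 - r" for x
      using cdf_nondecreasing[of s x] that by linarith
    then have "?B = {x. cdf M x < 1 - r}"
      by blast
    with False show ?thesis using prob_cdf_less[of "1 - r"] assms by simp
  qed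
  finally show ?thesis by simp
qed

text \<open>The value is the upper Frechet bound of \<open>joint_cdf_le\<close>, so the ascending
  coupling has the largest joint distribution function.\<close>

lemma prob_le_T_asc_le:
  assumes "cdf_distribution N"
  shows "prob {x. x \<le> s \<and> T_asc M N x \<le> t} = min (cdf M s) (cdf N t)"
proof -
  interpret N: cdf_distribution N by fact
  have [measurable]: "T_asc M N \<in> borel_measurable borel"
    by (rule borel_measurable_T_asc) fact
  have "prob {x. x \<le> s \<and> T_asc M N x \<le> t} = prob {x. x \<le> s \<and> cdf M x \<le> cdf N t}"
  proof (rule measure_eq_AE)
    show "AE x in M. x \<in> {x. x \<le> s \<and> T_asc M N x \<le> t} \<longleftrightarrow> x \<in> {x. x \<le> s \<and> cdf M x \<le> cdf N t}"
      using AE_T_asc_le_iff[OF assms] by eventually_elim simp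
  qed measurable
  then show ?thesis
    by (simp add: prob_le_cdf_le N.cdf_nonneg N.cdf_bounded_prob)
qed

text \<open>The value is the lower Frechet bound of \<open>joint_cdf_ge\<close>, so the descending
  coupling has the smallest joint distribution function.\<close>

lemma prob_le_T_desc_le:
  assumes "cdf_distribution N"
  shows "prob {x. x \<le> s \<and> T_desc M N x \<le> t} = max 0 (cdf M s + cdf N t - 1)"
proof -
  interpret N: cdf_distribution N by fact
  have [measurable]: "T_desc M N \<in> borel_measurable borel"
    by (rule borel_measurable_T_desc) fact
  have "prob {x. x \<le> s \<and> T_desc M N x \<le> t} = prob {x. x \<le> s \<and> 1 - cdf N t \<le> cdf M x}"
  proof (rule measure_eq_AE)
    show "AE x in M. x \<in> {x. x \<le> s \<and> T_desc M N x \<le> t} \<longleftrightarrow> x \<in> {x. x \<le> s \<and> 1 - cdf N t \<le> cdf M x}"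
      using AE_T_desc_le_iff[OF assms] by eventually_elim simp
  qed measurable
  then show ?thesis
    by (simp add: prob_le_cdf_ge N.cdf_nonneg N.cdf_bounded_prob)
qed

lemma distr_T_asc:
  assumes "cdf_distribution N"
  shows "distr M borel (T_asc M N) = N"
proof (rule cdf_unique)
  interpret N: cdf_distribution N by fact
  have T [measurable]: "T_asc M N \<in> borel_measurable borel"
    by (rule borel_measurable_T_asc) fact
  then show "real_distribution (distr M borel (T_asc M N))"
    by (intro real_distribution_distr) simp
  show "real_distribution N" ..
  show "cdf (distr M borel (T_asc M N)) = cdf N"
  proof
    fix t
    have "cdf (distr M borel (T_asc M N)) t = prob {x. T_asc M N x \<le> t}"
      by (simp add: cdf_def measure_distr vimage_def)
    also have "\<dots> = prob {x. cdf M x \<le> cdf N t}"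
    proof (rule measure_eq_AE)
      show "AE x in M. x \<in> {x. T_asc M N x \<le> t} \<longleftrightarrow> x \<in> {x. cdf M x \<le> cdf N t}"
        using AE_T_asc_le_iff[OF assms] by eventually_elim simp
    qed measurable
    also have "\<dots> = cdf N t"
      by (intro prob_cdf_le N.cdf_nonneg N.cdf_bounded_prob)
    finally show "cdf (distr M borel (T_asc M N)) t = cdf N t" .
  qed
qed

lemma distr_T_desc:
  assumes "cdf_distribution N"
  shows "distr M borel (T_desc M N) = N"
proof (rule cdf_unique)
  interpret N: cdf_distribution N by fact
  have T [measurable]: "T_desc M N \<in> borel_measurable borel"
    by (rule borel_measurable_T_desc) fact
  then show "real_distribution (distr M borel (T_desc M N))"
    by (intro real_distribution_distr) simp
  show "real_distribution N" ..
  show "cdf (distr M borel (T_desc M N)) = cdf N"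
  proof
    fix t
    have "cdf (distr M borel (T_desc M N)) t = prob {x. T_desc M N x \<le> t}"
      by (simp add: cdf_def measure_distr vimage_def)
    also have "\<dots> = prob (space M - {x. cdf M x < 1 - cdf N t})"
    proof (rule measure_eq_AE)
      show "AE x in M. x \<in> {x. T_desc M N x \<le> t} \<longleftrightarrow> x \<in> space M - {x. cdf M x < 1 - cdf N t}"
        using AE_T_desc_le_iff[OF assms] by eventually_elim (simp add: not_less)
    qed measurable
    also have "\<dots> = 1 - prob {x. cdf M x < 1 - cdf N t}"
      by (rule prob_compl) measurable
    also have "\<dots> = cdf N t"
      by (subst prob_cdf_less) (simp_all add: N.cdf_nonneg N.cdf_bounded_prob)
    finally show "cdf (distr M borel (T_desc M N)) t = cdf N t" .
  qed
qed

text \<open>The Galois connection at \<open>t = x\<close> gives only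
  \<open>T_asc M M x \<le> x\<close>, which can be strict where \<open>cdf M\<close> is flat.
  Equality of the two laws excludes this almost everywhere.\<close>

lemma AE_T_asc_self: "AE x in M. T_asc M M x = x"
proof (rule AE_eq_if_AE_le_distr_eq)
  have M: "cdf_distribution M" ..
  show "random_variable borel (T_asc M M)"
    using borel_measurable_T_asc[OF M] by simp
  show "AE x in M. T_asc M M x \<le> x"
    using AE_T_asc_le_iff[OF M] by eventually_elim simp
  show "distr M borel (T_asc M M) = distr M borel (\<lambda>x. x)"
    by (simp add: distr_T_asc[OF M] distr_id2)
qed simp

text \<open>Reflection exchanges \<open>cdf\<close> and \<open>anti_cdf\<close>, so the one-sided
  argument applies with \<open>t = - x\<close>.\<close>

lemma AE_T_desc_reflected: "AE x in M. T_desc M (distr M borel uminus) x = - x"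
proof (rule AE_eq_if_AE_le_distr_eq)
  let ?N = "distr M borel uminus"
  have N: "cdf_distribution ?N"
    by (simp add: cdf_distribution_def real_distribution_distr)
  show "random_variable borel (T_desc M ?N)"
    using borel_measurable_T_desc[OF N] by simp
  have *: "cdf ?N (- x) = 1 - cdf M x" for x
    unfolding anti_cdf_eq[symmetric] anti_cdf_def
    by (auto simp: cdf_def measure_distr intro!: arg_cong[where f=prob])
  show "AE x in M. T_desc M ?N x \<le> - x"
    using AE_T_desc_le_iff[OF N] by eventually_elim (simp add: *)
  show "distr M borel (T_desc M ?N) = ?N"
    by (rule distr_T_desc[OF N])
qed simp

end
end

subsection \<open>The cost of a coupling\<close>

lemma integrable_square_linear_combination:
  fixes f g :: "'a \<Rightarrow> real"
  assumes [measurable]: "f \<in> borel_measurable M" "g \<in> borel_measurable M"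
    and "integrable M (\<lambda>x. (f x)\<^sup>2)" "integrable M (\<lambda>x. (g x)\<^sup>2)"
  shows "integrable M (\<lambda>x. (a * f x + b * g x)\<^sup>2)"
proof (rule Bochner_Integration.integrable_bound)
  show "integrable M (\<lambda>x. 2 * a\<^sup>2 * (f x)\<^sup>2 + 2 * b\<^sup>2 * (g x)\<^sup>2)"
    using assms by simp
  have "(u + v)\<^sup>2 \<le> 2 * u\<^sup>2 + 2 * v\<^sup>2" for u v :: real
    using sum_squares_bound[of u v] by (simp add: power2_sum)
  from this[of "a * _" "b * _"]
  show "AE x in M. norm ((a * f x + b * g x)\<^sup>2) \<le> norm (2 * a\<^sup>2 * (f x)\<^sup>2 + 2 * b\<^sup>2 * (g x)\<^sup>2)"
    by (intro AE_I2) (simp add: power_mult_distrib mult.assoc)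
qed measurable

lemma gw_optimalI:
  assumes "coupling \<gamma> \<mu> \<nu>" "\<And>\<pi>. coupling \<pi> \<mu> \<nu> \<Longrightarrow> gw_cost \<gamma> \<le> gw_cost \<pi>"
  shows "gw_optimal \<mu> \<nu> \<gamma>"
  using assms unfolding gw_optimal_def mem_couplings_iff
  by (auto intro!: antisym INF_greatest INF_lower2[of \<gamma>] simp: mem_couplings_iff)

context coupling
begin

lemma integrable_mult_if_square_integrable:
  assumes "integrable \<mu> (\<lambda>x. x\<^sup>2)" "integrable \<nu> (\<lambda>y. y\<^sup>2)"
  shows "integrable \<pi> (\<lambda>z. fst z * snd z)"
proof (rule Bochner_Integration.integrable_bound)
  show "integrable \<pi> (\<lambda>z. (fst z)\<^sup>2 + (snd z)\<^sup>2)"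
    using assms integrable_fst_iff[of "\<lambda>x. x\<^sup>2"] integrable_snd_iff[of "\<lambda>x. x\<^sup>2"] by simp
  have "\<bar>u * v\<bar> \<le> \<bar>u\<^sup>2 + v\<^sup>2\<bar>" for u v :: real
  proof -
    have "2 * \<bar>u * v\<bar> \<le> u\<^sup>2 + v\<^sup>2"
      using sum_squares_bound[of "\<bar>u\<bar>" "\<bar>v\<bar>"] by (simp add: abs_mult mult.assoc)
    then show ?thesis by linarith
  qed
  then show "AE z in \<pi>. norm (fst z * snd z) \<le> norm ((fst z)\<^sup>2 + (snd z)\<^sup>2)"
    by simp
qed measurable

lemma gw_cost_eq:
  assumes "integrable \<mu> (\<lambda>x. x\<^sup>2)" "integrable \<nu> (\<lambda>y. y\<^sup>2)"
  shows "gw_cost \<pi> = ennreal ((\<integral>x. x\<^sup>2 \<partial>\<mu>)\<^sup>2 + (\<integral>y. y\<^sup>2 \<partial>\<nu>)\<^sup>2 - 2 * (\<integral>z. fst z * snd z \<partial>\<pi>)\<^sup>2)"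
proof -
  define A B C where "A = (\<integral>x. x\<^sup>2 \<partial>\<mu>)" and "B = (\<integral>y. y\<^sup>2 \<partial>\<nu>)" and "C = (\<integral>z. fst z * snd z \<partial>\<pi>)"
  have int [simp]: "integrable \<pi> (\<lambda>z. (fst z)\<^sup>2)" "integrable \<pi> (\<lambda>z. (snd z)\<^sup>2)" "integrable \<pi> (\<lambda>z. fst z * snd z)"
    using assms integrable_fst_iff[of "\<lambda>x. x\<^sup>2"] integrable_snd_iff[of "\<lambda>x. x\<^sup>2"]
      integrable_mult_if_square_integrable by simp_all
  have eqs: "(\<integral>z. (fst z)\<^sup>2 \<partial>\<pi>) = A" "(\<integral>z. (snd z)\<^sup>2 \<partial>\<pi>) = B" "(\<integral>z. fst z * snd z \<partial>\<pi>) = C"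
    using integral_fst_eq[of "\<lambda>x. x\<^sup>2"] integral_snd_eq[of "\<lambda>x. x\<^sup>2"] by (simp_all add: A_def B_def C_def)
  \<comment> \<open>This serves both integrations: the inner one with coefficients built from
    \<open>x'\<close> and \<open>y'\<close>, the outer one with coefficients \<open>A\<close>,
    \<open>B\<close> and \<open>2 * C\<close>.\<close>
  have form: "integrable \<pi> (\<lambda>z. p * (fst z)\<^sup>2 + q * (snd z)\<^sup>2 - r * (fst z * snd z))"
    "(\<integral>z. p * (fst z)\<^sup>2 + q * (snd z)\<^sup>2 - r * (fst z * snd z) \<partial>\<pi>) = p * A + q * B - r * C" for p q r
    by (simp_all add: eqs)
  have expand: "(x * x' - y * y')\<^sup>2 = x'\<^sup>2 * x\<^sup>2 + y'\<^sup>2 * y\<^sup>2 - (2 * x' * y') * (x * y)" for x x' y y' :: real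
    by (simp add: power2_eq_square algebra_simps)
  \<comment> \<open>The quadratic form is an integral of squares, hence nonnegative. The outer
    integral needs this to pass from \<open>ennreal\<close> to real values.\<close>
  have nonneg: "0 \<le> x'\<^sup>2 * A + y'\<^sup>2 * B - (2 * x' * y') * C" for x' y'
    unfolding form(2)[symmetric] expand[symmetric] by simp
  have inner: "(\<integral>\<^sup>+ z. ennreal ((fst z * x' - snd z * y')\<^sup>2) \<partial>\<pi>) =
      ennreal (x'\<^sup>2 * A + y'\<^sup>2 * B - (2 * x' * y') * C)" for x' y'
    unfolding form(2)[symmetric] expand[symmetric]
    by (rule nn_integral_eq_integral) (simp_all only: expand form, simp flip: expand)
  have "gw_cost \<pi> = (\<integral>\<^sup>+ z. ennreal (A * (fst z)\<^sup>2 + B * (snd z)\<^sup>2 - (2 * C) * (fst z * snd z)) \<partial>\<pi>)"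
    unfolding gw_cost_def split_beta' inner by (simp add: ac_simps)
  also have "\<dots> = ennreal (A * A + B * B - (2 * C) * C)"
    unfolding form(2)[symmetric]
  proof (intro nn_integral_eq_integral form AE_I2)
    show "0 \<le> A * (fst z)\<^sup>2 + B * (snd z)\<^sup>2 - (2 * C) * (fst z * snd z)" for z
      using nonneg[of "fst z" "snd z"] by (simp add: ac_simps)
  qed
  finally show ?thesis
    by (simp add: A_def B_def C_def power2_eq_square mult.assoc)
qed

lemma gw_cost_eq_0:
  assumes "c\<^sup>2 = 1" and AE: "AE z in \<pi>. snd z = c * fst z"
  shows "gw_cost \<pi> = 0"
proof -
  have eq: "fst z * fst z' - c * fst z * (c * fst z') = 0" for z z' :: "real \<times> real"
    using assms(1) by (simp add: power2_eq_square algebra_simps)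
  have "(\<integral>\<^sup>+ z. ennreal ((fst z * fst z' - snd z * snd z')\<^sup>2) \<partial>\<pi>) = 0" if "snd z' = c * fst z'" for z'
  proof -
    have "(\<integral>\<^sup>+ z. ennreal ((fst z * fst z' - snd z * snd z')\<^sup>2) \<partial>\<pi>) = (\<integral>\<^sup>+ z. 0 \<partial>\<pi>)"
      by (rule nn_integral_cong_AE) (use AE in eventually_elim, simp add: that eq)
    then show ?thesis by simp
  qed
  then have "gw_cost \<pi> = (\<integral>\<^sup>+ z. 0 \<partial>\<pi>)"
    unfolding gw_cost_def split_beta'
    by (intro nn_integral_cong_AE) (use AE in eventually_elim, simp)
  then show ?thesis by simp
qed

lemma snd_marginal_eq:
  assumes "AE z in \<pi>. snd z = c * fst z"
  shows "\<nu> = distr \<mu> borel (\<lambda>x. c * x)"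
proof -
  have "\<nu> = distr \<pi> borel (\<lambda>z. c * fst z)"
    unfolding distr_snd[symmetric] using assms by (intro distr_cong_AE) simp_all
  also have "\<dots> = distr \<mu> borel (\<lambda>x. c * x)"
    unfolding distr_fst[symmetric] by (subst distr_distr) (simp_all add: comp_def)
  finally show ?thesis .
qed

text \<open>If the cost is finite, then \<open>x x' - y y'\<close> is square integrable in \<open>(x, y)\<close> for almost every
  \<open>(x', y')\<close>. Two linearly independent such points would make both coordinates square integrable,
  so the coupling lives on a line, and finiteness of the cost then fixes the slope.\<close>

lemma collinear_if_gw_cost_finite:
  assumes fin: "gw_cost \<pi> < \<infinity>" and nz: "AE x in \<mu>. x \<noteq> 0"
    and ninf: "\<not> (integrable \<mu> (\<lambda>x. x\<^sup>2) \<and> integrable \<nu> (\<lambda>y. y\<^sup>2))"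
  obtains c where "c\<^sup>2 = 1" "AE z in \<pi>. snd z = c * fst z"
proof -
  \<comment> \<open>For fixed \<open>w\<close> the integrand is the square of a linear form in
    \<open>z\<close>.\<close>
  define Q where "Q w z = fst z * fst w - snd z * snd w" for w z :: "real \<times> real"
  have Q [measurable]: "Q w \<in> borel_measurable \<pi>" for w
    unfolding Q_def by measurable
  have ninf': "\<not> (integrable \<pi> (\<lambda>z. (fst z)\<^sup>2) \<and> integrable \<pi> (\<lambda>z. (snd z)\<^sup>2))"
    using ninf integrable_fst_iff[of "\<lambda>x. x\<^sup>2"] integrable_snd_iff[of "\<lambda>x. x\<^sup>2"] by simp
  have "AE w in \<pi>. (\<integral>\<^sup>+ z. ennreal ((Q w z)\<^sup>2) \<partial>\<pi>) \<noteq> \<infinity>"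
  proof (rule nn_integral_PInf_AE)
    show "(\<integral>\<^sup>+ w. \<integral>\<^sup>+ z. ennreal ((Q w z)\<^sup>2) \<partial>\<pi> \<partial>\<pi>) \<noteq> \<infinity>"
      using fin by (simp add: gw_cost_def Q_def split_beta')
    show "(\<lambda>w. \<integral>\<^sup>+ z. ennreal ((Q w z)\<^sup>2) \<partial>\<pi>) \<in> borel_measurable \<pi>"
      unfolding Q_def by measurable
  qed
  then have int: "AE w in \<pi>. integrable \<pi> (\<lambda>z. (Q w z)\<^sup>2)"
    by eventually_elim (auto intro!: integrableI_nonneg simp: less_top)
  \<comment> \<open>A base point off the vertical axis lets the line through it and the origin be
    written with a slope \<open>c\<close>.\<close>
  have "AE w in \<pi>. fst w \<noteq> 0"
    using nz unfolding distr_fst[symmetric] by (subst (asm) AE_distr_iff) simp_all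
  with int have "AE w in \<pi>. integrable \<pi> (\<lambda>z. (Q w z)\<^sup>2) \<and> fst w \<noteq> 0"
    by eventually_elim simp
  moreover have "ae_filter \<pi> \<noteq> bot"
    using emeasure_space_1 by (simp add: ae_filter_eq_bot_iff)
  ultimately obtain w0 where w0: "integrable \<pi> (\<lambda>z. (Q w0 z)\<^sup>2)" "fst w0 \<noteq> 0"
    using eventually_happens' by blast
  define c where "c = snd w0 / fst w0"
  have col: "snd w = c * fst w" if w: "integrable \<pi> (\<lambda>z. (Q w z)\<^sup>2)" for w
  proof (rule ccontr)
    assume "snd w \<noteq> c * fst w"
    \<comment> \<open>Up to sign, \<open>d\<close> is the determinant of the linear forms
      \<open>Q w0\<close> and \<open>Q w\<close>. Cramer's rule then expresses both coordinates of
      \<open>z\<close> through them.\<close>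
    define d where "d = snd w * fst w0 - snd w0 * fst w"
    have d: "d \<noteq> 0"
      using \<open>snd w \<noteq> c * fst w\<close> w0(2) by (simp add: d_def c_def field_simps)
    have sq: "(\<lambda>z. (fst z)\<^sup>2) = (\<lambda>z. ((snd w / d) * Q w0 z + (- snd w0 / d) * Q w z)\<^sup>2)"
      "(\<lambda>z. (snd z)\<^sup>2) = (\<lambda>z. ((fst w / d) * Q w0 z + (- fst w0 / d) * Q w z)\<^sup>2)"
    proof -
      have "snd w * Q w0 z - snd w0 * Q w z = d * fst z" "fst w * Q w0 z - fst w0 * Q w z = d * snd z" for z
        by (simp_all add: Q_def d_def algebra_simps)
      then have "(snd w / d) * Q w0 z + (- snd w0 / d) * Q w z = fst z"
        "(fst w / d) * Q w0 z + (- fst w0 / d) * Q w z = snd z" for z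
        using d by (simp_all add: field_simps)
      then show "(\<lambda>z. (fst z)\<^sup>2) = (\<lambda>z. ((snd w / d) * Q w0 z + (- snd w0 / d) * Q w z)\<^sup>2)"
        "(\<lambda>z. (snd z)\<^sup>2) = (\<lambda>z. ((fst w / d) * Q w0 z + (- fst w0 / d) * Q w z)\<^sup>2)"
        by (simp_all only:)
    qed
    have "integrable \<pi> (\<lambda>z. (fst z)\<^sup>2)" "integrable \<pi> (\<lambda>z. (snd z)\<^sup>2)"
      unfolding sq by (rule integrable_square_linear_combination[OF Q Q w0(1) w])+
    with ninf' show False by blast
  qed
  have AE: "AE z in \<pi>. snd z = c * fst z"
    using int by eventually_elim (rule col)
  have "c\<^sup>2 = 1"
  proof (rule ccontr)
    assume "c\<^sup>2 \<noteq> 1"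
    \<comment> \<open>On the line, \<open>Q w0 z\<close> equals \<open>e * fst z\<close>. If
      \<open>e\<close> is nonzero, square integrability passes to \<open>fst\<close>, then to
      \<open>snd\<close>, contradicting \<open>ninf'\<close>.\<close>
    define e where "e = fst w0 * (1 - c\<^sup>2)"
    have "e \<noteq> 0"
      using \<open>c\<^sup>2 \<noteq> 1\<close> w0(2) by (simp add: e_def)
    have "snd w0 = c * fst w0"
      using w0 by (intro col)
    then have eq: "Q w0 z = e * fst z" if "snd z = c * fst z" for z
      using that by (simp add: Q_def e_def power2_eq_square algebra_simps)
    have "integrable \<pi> (\<lambda>z. (1 / e)\<^sup>2 * (Q w0 z)\<^sup>2)"
      using w0(1) by simp
    moreover have "AE z in \<pi>. (1 / e)\<^sup>2 * (Q w0 z)\<^sup>2 = (fst z)\<^sup>2"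
      using AE by eventually_elim (simp add: eq \<open>e \<noteq> 0\<close> power_mult_distrib power_divide)
    ultimately have x: "integrable \<pi> (\<lambda>z. (fst z)\<^sup>2)"
      by (subst (asm) integrable_cong_AE) simp_all
    then have "integrable \<pi> (\<lambda>z. c\<^sup>2 * (fst z)\<^sup>2)"
      by simp
    moreover have "AE z in \<pi>. c\<^sup>2 * (fst z)\<^sup>2 = (snd z)\<^sup>2"
      using AE by eventually_elim (simp add: power_mult_distrib)
    ultimately have "integrable \<pi> (\<lambda>z. (snd z)\<^sup>2)"
      by (subst (asm) integrable_cong_AE) simp_all
    with x ninf' show False by simp
  qed
  then show ?thesis
    using AE by (rule that)
qed

end

section \<open>Couplings carried by the graph of a map\<close>

context
  fixes \<mu> :: "real measure" and T :: "real \<Rightarrow> real"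
  assumes \<mu>: "real_distribution \<mu>" and T [measurable]: "T \<in> borel_measurable borel"
begin

interpretation real_distribution \<mu> by (rule \<mu>)

lemma coupling_graph_pushforward: "coupling (graph_pushforward \<mu> T) \<mu> (distr \<mu> borel T)"
proof -
  interpret g: prob_space "graph_pushforward \<mu> T"
    unfolding graph_pushforward_def by (rule prob_space_distr) measurable
  have "distr (graph_pushforward \<mu> T) borel fst = \<mu>"
    unfolding graph_pushforward_def by (subst distr_distr) (simp_all add: comp_def distr_id2)
  moreover have "distr (graph_pushforward \<mu> T) borel snd = distr \<mu> borel T"
    unfolding graph_pushforward_def by (subst distr_distr) (simp_all add: comp_def)
  ultimately show ?thesis
    by unfold_locales (simp_all add: graph_pushforward_def)
qed

lemma joint_cdf_graph_pushforward:
  "joint_cdf (graph_pushforward \<mu> T) s t = prob {x. x \<le> s \<and> T x \<le> t}"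
  unfolding joint_cdf_def graph_pushforward_def
  by (subst measure_distr) (auto simp: vimage_def)

lemma AE_graph_pushforward:
  assumes "AE x in \<mu>. T x = c * x"
  shows "AE z in graph_pushforward \<mu> T. snd z = c * fst z"
  unfolding graph_pushforward_def
  using assms by (subst AE_distr_iff) simp_all

end

section \<open>Optimality of the ascending or the descending coupling\<close>

theorem theorem4p2p4:
  fixes \<mu> \<nu> :: "real measure"
  assumes "real_distribution \<mu>" and "real_distribution \<nu>"
    and "absolutely_continuous lborel \<mu>"
  shows "gw_optimal \<mu> \<nu> (graph_pushforward \<mu> (T_asc \<mu> \<nu>)) \<or>
         gw_optimal \<mu> \<nu> (graph_pushforward \<mu> (T_desc \<mu> \<nu>))"
proof -
  interpret \<mu>: cdf_distribution \<mu>
    unfolding cdf_distribution_def by fact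
  have \<nu>: "cdf_distribution \<nu>"
    unfolding cdf_distribution_def by fact
  have null: "{x} \<in> null_sets \<mu>" for x
    using assms(3) unfolding absolutely_continuous_def by (rule subsetD) (simp add: null_sets_def)
  then have atomless: "measure \<mu> {x} = 0" for x
    by (simp add: null_sets_def measure_def)
  define asc desc where "asc = graph_pushforward \<mu> (T_asc \<mu> \<nu>)"
    and "desc = graph_pushforward \<mu> (T_desc \<mu> \<nu>)"
  note meas = \<mu>.borel_measurable_T_asc[OF atomless \<nu>] \<mu>.borel_measurable_T_desc[OF atomless \<nu>]
  have asc: "coupling asc \<mu> \<nu>"
    using coupling_graph_pushforward[OF assms(1) meas(1)] by (simp add: asc_def \<mu>.distr_T_asc[OF atomless \<nu>])
  have desc: "coupling desc \<mu> \<nu>"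
    using coupling_graph_pushforward[OF assms(1) meas(2)] by (simp add: desc_def \<mu>.distr_T_desc[OF atomless \<nu>])
  have "gw_optimal \<mu> \<nu> asc \<or> gw_optimal \<mu> \<nu> desc"
  proof (cases "integrable \<mu> (\<lambda>x. x\<^sup>2) \<and> integrable \<nu> (\<lambda>y. y\<^sup>2)")
    case True
    define C where "C \<pi> = (\<integral>z. fst z * snd z \<partial>\<pi>)" for \<pi> :: "(real \<times> real) measure"
    \<comment> \<open>The second moments are shared by all couplings, so a larger
      \<open>\<bar>C \<pi>\<bar>\<close> means a smaller cost.\<close>
    have le: "gw_cost \<pi> \<le> gw_cost \<pi>'" if "coupling \<pi> \<mu> \<nu>" "coupling \<pi>' \<mu> \<nu>" "\<bar>C \<pi>'\<bar> \<le> \<bar>C \<pi>\<bar>" for \<pi> \<pi>'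
      using that True by (auto simp: coupling.gw_cost_eq C_def abs_le_square_iff intro!: ennreal_leI)
    have bounds: "C desc \<le> C \<pi>" "C \<pi> \<le> C asc" if \<pi>: "coupling \<pi> \<mu> \<nu>" for \<pi>
    proof -
      note int = coupling.integrable_mult_if_square_integrable[OF _ conjunct1[OF True] conjunct2[OF True]]
      show "C \<pi> \<le> C asc"
        unfolding C_def
      proof (rule integral_mult_mono_joint_cdf[OF \<pi> asc int[OF \<pi>] int[OF asc]])
        show "joint_cdf \<pi> s t \<le> joint_cdf asc s t" for s t
          using coupling.joint_cdf_le[OF \<pi>, of s t]
          by (simp add: asc_def joint_cdf_graph_pushforward[OF assms(1) meas(1)]
              \<mu>.prob_le_T_asc_le[OF atomless \<nu>])
      qed
      show "C desc \<le> C \<pi>"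
        unfolding C_def
      proof (rule integral_mult_mono_joint_cdf[OF desc \<pi> int[OF desc] int[OF \<pi>]])
        show "joint_cdf desc s t \<le> joint_cdf \<pi> s t" for s t
          using coupling.joint_cdf_ge[OF \<pi>, of s t]
          by (simp add: desc_def joint_cdf_graph_pushforward[OF assms(1) meas(2)]
              \<mu>.prob_le_T_desc_le[OF atomless \<nu>])
      qed
    qed
    show ?thesis
    \<comment> \<open>On the interval from \<open>C desc\<close> to \<open>C asc\<close> the
      absolute value is maximal at an endpoint.\<close>
    proof (cases "\<bar>C desc\<bar> \<le> \<bar>C asc\<bar>")
      case True
      have "\<bar>C \<pi>\<bar> \<le> \<bar>C asc\<bar>" if "coupling \<pi> \<mu> \<nu>" for \<pi>
        using bounds[OF that] True by linarith
      then show ?thesis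
        by (intro disjI1 gw_optimalI asc le)
    next
      case False
      have "\<bar>C \<pi>\<bar> \<le> \<bar>C desc\<bar>" if "coupling \<pi> \<mu> \<nu>" for \<pi>
        using bounds[OF that] False by linarith
      then show ?thesis
        by (intro disjI2 gw_optimalI desc le)
    qed
  next
    case infinite: False
    show ?thesis
    proof (cases "\<exists>\<pi>. coupling \<pi> \<mu> \<nu> \<and> gw_cost \<pi> < \<infinity>")
      case True
      then obtain \<pi> where \<pi>: "coupling \<pi> \<mu> \<nu>" "gw_cost \<pi> < \<infinity>"
        by blast
      have "AE x in \<mu>. x \<noteq> 0"
        using AE_not_in[OF null[of 0]] by simp
      then obtain c where c: "c\<^sup>2 = 1" "AE z in \<pi>. snd z = c * fst z"
        using coupling.collinear_if_gw_cost_finite[OF \<pi> _ infinite] by blast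
      \<comment> \<open>The coupling \<open>\<pi>\<close> only serves to identify
        \<open>\<nu>\<close> as \<open>\<mu>\<close> or its reflection. The monotone map is then
        compared with \<open>x\<close> or \<open>- x\<close> directly.\<close>
      have \<nu>_eq: "\<nu> = distr \<mu> borel (\<lambda>x. c * x)"
        by (rule coupling.snd_marginal_eq[OF \<pi>(1) c(2)])
      have "c = 1 \<or> c = - 1"
        using c(1) by (simp add: power2_eq_1_iff)
      then show ?thesis
      proof
        assume "c = 1"
        then have "\<nu> = \<mu>"
          using \<nu>_eq by (simp add: distr_id2)
        then have "AE x in \<mu>. T_asc \<mu> \<nu> x = 1 * x"
          using \<mu>.AE_T_asc_self[OF atomless] by simp
        then have "AE z in asc. snd z = 1 * fst z"
          unfolding asc_def by (rule AE_graph_pushforward[OF assms(1) meas(1)])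
        then have "gw_cost asc = 0"
          by (intro coupling.gw_cost_eq_0[OF asc, of 1]) simp_all
        then show ?thesis
          by (intro disjI1 gw_optimalI asc) simp
      next
        assume "c = - 1"
        then have "\<nu> = distr \<mu> borel uminus"
          using \<nu>_eq by simp
        then have "AE x in \<mu>. T_desc \<mu> \<nu> x = - 1 * x"
          using \<mu>.AE_T_desc_reflected[OF atomless] by simp
        then have "AE z in desc. snd z = - 1 * fst z"
          unfolding desc_def by (rule AE_graph_pushforward[OF assms(1) meas(2)])
        then have "gw_cost desc = 0"
          by (intro coupling.gw_cost_eq_0[OF desc, of "- 1"]) simp_all
        then show ?thesis
          by (intro disjI2 gw_optimalI desc) simp
      qed
    next
      \<comment> \<open>Every coupling now has infinite cost, so the infimum is infinite and any
        coupling attains it.\<close>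
      case False
      then have "gw_cost \<pi> = \<infinity>" if "coupling \<pi> \<mu> \<nu>" for \<pi>
        using that by (auto simp: less_top[symmetric])
      then show ?thesis
        by (intro disjI1 gw_optimalI asc) simp
    qed
  qed
  then show ?thesis
    by (simp add: asc_def desc_def)
qed

end
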